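(* Let $A(t)$, $t\in\mathbb{R}$, be a continuous and bounded $n\times n$ matrix function, let $f:\mathbb{R}\times X\to X$ be continuous, and consider the nonlinear system $x'=A(t)x+f(t,x)$ and the linear system $x'=A(t)x$. Suppose that the linear system admits an exponential trichotomy with projections $P,Q$ and constants $\beta\ge1$, $\alpha>0$ and let $G(t,s)$ be its Green function. Suppose there are constants $\mu,\gamma\ge0$ such that for all $t\in\mathbb{R}$ and $x,x_1,x_2\in X$ $$|f(t,x)|\le\mu,\qquad |f(t,x_1)-f(t,x_2)|\le\gamma|x_1-x_2|,\qquad 3\beta\gamma\alpha^{-1}<1.$$ Suppose there are continuous functions $\Delta_1(t,s)>0$ and $\Delta_2(t,s)>0$ such that $|z_1(t)-z_2(t)|\le\Delta_1(t,s)|z_1(s)-z_2(s)|$ for any two solutions $z_1,z_2$ of the linear system and $|z_3(t)-z_4(t)|\le\Delta_2(t,s)|z_3(s)-z_4(s)|$ for any two solutions $z_3,z_4$ of the nonlinear system, for all $t,s\in\mathbb{R}$. Let $p>0$ and $0<q<1$ be such that $$m\sup_{t\in\mathbb{R}}\int_{-\infty}^{+\infty}|G(t,s)|\Delta_1^{q}(t,s)\,ds\le\frac{p}{1+p},\qquad m\sup_{t\in\mathbb{R}}\int_{-\infty}^{+\infty}|G(t,s)|\Delta_2^{q}(t,s)\,ds\le\frac{p}{1+p},$$ where $m=\max\{\gamma,2\mu^{1-q}\gamma^{q}\}$. Then the nonlinear system is topologically conjugated to the linear system by an equivalent function $\mathscr H$ which, together with $\mathscr L(t,\cdot)=\mathscr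 H^{-1}(t,\cdot)$, satisfies for all $t\in\mathbb{R}$ $$|\mathscr H(t,x)-\mathscr H(t,x')|\le(1+p)|x-x'|^{q}\quad\text{if } |x-x'|<1,$$ $$|\mathscr L(t,y)-\mathscr L(t,y')|\le(1+p)|y-y'|^{q}\quad\text{if } |y-y'|<1.$$
   Context: $(X,|\cdot|)$ is a Banach space on which $n\times n$ matrices act, i.e. $X=\mathbb{R}^n$ with norm $|\cdot|$; matrices carry the induced operator norm. Exponential trichotomy: the linear system $x'=A(t)x$ with fundamental matrix $U(t)$ admits an exponential trichotomy if there exist projections $P,Q$ and constants $\beta\ge1$, $\alpha>0$ such that $PQ=QP$, $P+Q-PQ=I$, and - $|U(t)PU^{-1}(s)|\le\beta e^{-\alpha(t-s)}$ for $0\le s\le t$; - $|U(t)(I-P)U^{-1}(s)|\le\beta e^{-\alpha(s-t)}$ for $t\le s$, $s\ge0$; - $|U(t)QU^{-1}(s)|\le\beta e^{-\alpha(s-t)}$ for $t\le s\le0$; - $|U(t)(I-Q)U^{-1}(s)|\le\beta e^{-\alpha(t-s)}$ for $s\le t$, $s\le0$. Green function: $G(t,s)=U(t)PU^{-1}(s)$ for $0\le s\le t$; $G(t,s)=-U(t)(I-P)U^{-1}(s)$ for $t\le s$, $s\ge0$; $G(t,s)=-U(t)QU^{-1}(s)$ for $t\le s\le0$; $G(t,s)=U(t)(I-Q)U^{-1}(s)$ for $s\le t$, $s\le0$ (the overlaps at $s=t$ and $s=0$ are immaterial in integrals over $s$). Topological conjugacy: the system $x'=A(t)x+f(t,x)$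 is topologically conjugated to $x'=A(t)x$ if there is a function $\mathscr H:\mathbb{R}\times X\to X$ (called an equivalent function) such that (i) for each fixed $t$, $\mathscr H(t,\cdot)$ is a homeomorphism of $X$ into $X$ (with inverse defined on $X$); (ii) $|\mathscr H(t,x)-x|$ is uniformly bounded with respect to $t$; (iii) $\mathscr L(t,\cdot)=\mathscr H^{-1}(t,\cdot)$ also has property (ii); (iv) if $x(t)$ is a solution of $x'=A(t)x+f(t,x)$, then $\mathscr H(t,x(t))$ is a solution of $x'=A(t)x$, and if $y(t)$ is a solution of $x'=A(t)x$, then $\mathscr L(t,y(t))$ is a solution of $x'=A(t)x+f(t,x)$.
   Formalization: In the two integral conditions the weights Δ₁^q(t,s), Δ₂^q(t,s) are replaced by Δ₁^q(s,t), Δ₂^q(s,t); with the printed order the claim fails, e.g. for x'=-x and f(x)=-0.3·max(-1,min(1,x)) with q=0.9, p=1. *)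

theory Defs
  imports "HOL-Analysis.Analysis"
begin

text \<open>
  The state space is \<open>\<real>\<^sup>n\<close> with an arbitrary norm \<open>N\<close>, not necessarily the Euclidean one carried by
  the type \<^typ>\<open>real ^ 'n\<close>. Continuity, derivatives and boundedness of matrix functions do not
  depend on the choice of norm and are taken from the library.
\<close>

definition is_norm :: "('a::real_vector \<Rightarrow> real) \<Rightarrow> bool" where
  "is_norm N \<longleftrightarrow>
     (\<forall>x. N x = 0 \<longleftrightarrow> x = 0) \<and>
     (\<forall>x y. N (x + y) \<le> N x + N y) \<and>
     (\<forall>c x. N (c *\<^sub>R x) = \<bar>c\<bar> * N x)"

text \<open>Induced operator norm; same shape as \<^const>\<open>onorm\<close>, with \<open>0 / 0 = 0\<close> at \<open>x = 0\<close>.\<close>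

definition op_norm :: "(real ^ 'n \<Rightarrow> real) \<Rightarrow> real ^ 'n ^ 'n \<Rightarrow> real" where
  "op_norm N M = (SUP x. N (M *v x) / N x)"

definition solution :: "(real \<Rightarrow> real ^ 'n \<Rightarrow> real ^ 'n) \<Rightarrow> (real \<Rightarrow> real ^ 'n) \<Rightarrow> bool" where
  "solution F x \<longleftrightarrow> (\<forall>t. (x has_vector_derivative F t (x t)) (at t))"

definition lin_field ::
  "(real \<Rightarrow> real ^ 'n ^ 'n) \<Rightarrow> real \<Rightarrow> real ^ 'n \<Rightarrow> real ^ 'n" where
  "lin_field A t x = A t *v x"

definition nonlin_field ::
  "(real \<Rightarrow> real ^ 'n ^ 'n) \<Rightarrow> (real \<Rightarrow> real ^ 'n \<Rightarrow> real ^ 'n) \<Rightarrow>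
     real \<Rightarrow> real ^ 'n \<Rightarrow> real ^ 'n" where
  "nonlin_field A f t x = A t *v x + f t x"

definition fundamental_matrix ::
  "(real \<Rightarrow> real ^ 'n ^ 'n) \<Rightarrow> (real \<Rightarrow> real ^ 'n ^ 'n) \<Rightarrow> bool" where
  "fundamental_matrix A U \<longleftrightarrow>
     (\<forall>t. (U has_vector_derivative A t ** U t) (at t)) \<and> (\<forall>t. invertible (U t))"

definition exponential_trichotomy ::
  "(real ^ 'n \<Rightarrow> real) \<Rightarrow> (real \<Rightarrow> real ^ 'n ^ 'n) \<Rightarrow>
     real ^ 'n ^ 'n \<Rightarrow> real ^ 'n ^ 'n \<Rightarrow> real \<Rightarrow> real \<Rightarrow> bool" where
  "exponential_trichotomy N U P Q \<beta> \<alpha> \<longleftrightarrow>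
     P ** P = P \<and> Q ** Q = Q \<and> \<beta> \<ge> 1 \<and> \<alpha> > 0 \<and>
     P ** Q = Q ** P \<and> P + Q - P ** Q = mat 1 \<and>
     (\<forall>t s. 0 \<le> s \<and> s \<le> t \<longrightarrow>
        op_norm N (U t ** P ** matrix_inv (U s)) \<le> \<beta> * exp (- \<alpha> * (t - s))) \<and>
     (\<forall>t s. t \<le> s \<and> 0 \<le> s \<longrightarrow>
        op_norm N (U t ** (mat 1 - P) ** matrix_inv (U s)) \<le> \<beta> * exp (- \<alpha> * (s - t))) \<and>
     (\<forall>t s. t \<le> s \<and> s \<le> 0 \<longrightarrow>
        op_norm N (U t ** Q ** matrix_inv (U s)) \<le> \<beta> * exp (- \<alpha> * (s - t))) \<and>
     (\<forall>t s. s \<le> t \<and> s \<le> 0 \<longrightarrow>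
        op_norm N (U t ** (mat 1 - Q) ** matrix_inv (U s)) \<le> \<beta> * exp (- \<alpha> * (t - s)))"

text \<open>
  The four regions overlap where \<open>s = t\<close> or \<open>s = 0\<close>; the order of the cases picks a value there,
  which is irrelevant under integrals over \<open>s\<close>.
\<close>

definition green ::
  "(real \<Rightarrow> real ^ 'n ^ 'n) \<Rightarrow> real ^ 'n ^ 'n \<Rightarrow> real ^ 'n ^ 'n \<Rightarrow>
     real \<Rightarrow> real \<Rightarrow> real ^ 'n ^ 'n" where
  "green U P Q t s =
     (if 0 \<le> s \<and> s \<le> t then U t ** P ** matrix_inv (U s)
      else if t \<le> s \<and> 0 \<le> s then - (U t ** (mat 1 - P) ** matrix_inv (U s))
      else if t \<le> s \<and> s \<le> 0 then - (U t ** Q ** matrix_inv (U s))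
      else U t ** (mat 1 - Q) ** matrix_inv (U s))"

text \<open>
  \<open>\<Delta> t s\<close> bounds the divergence of solutions at time \<open>t\<close> in terms of their distance at time \<open>s\<close>.
  An integral \<open>\<integral> G(t,s) h(s) ds\<close> along solutions with prescribed values at time \<open>t\<close> involves their
  divergence at time \<open>s\<close>. Hence the weight that goes with \<open>G(t,s)\<close> is \<open>\<Delta> s t\<close>, not \<open>\<Delta> t s\<close>. The
  two agree for symmetric bounds such as \<open>exp (K * \<bar>t - s\<bar>)\<close>, but in general \<open>\<Delta> t s\<close> would not
  give Hoelder conjugacies: for the scalar systems \<open>x' = - x\<close> and \<open>x' = - x + f x\<close> with
  \<open>f x = - 0.3 * max (-1) (min 1 x)\<close>, the integrals of \<open>\<bar>G(t,s)\<bar> * \<Delta> t s powr q\<close> are \<open>1 / (1 + q)\<close>,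
  while no conjugacy is Hoelder near \<open>0\<close> with an exponent \<open>q > 1 / 1.3\<close>.
\<close>

definition divergence_bound ::
  "(real ^ 'n \<Rightarrow> real) \<Rightarrow> (real \<Rightarrow> real ^ 'n \<Rightarrow> real ^ 'n) \<Rightarrow> (real \<Rightarrow> real \<Rightarrow> real) \<Rightarrow> bool" where
  "divergence_bound N F \<Delta> \<longleftrightarrow>
     (\<forall>z w. solution F z \<longrightarrow> solution F w \<longrightarrow>
        (\<forall>t s. N (z t - w t) \<le> \<Delta> t s * N (z s - w s)))"

definition equivalent_function ::
  "(real ^ 'n \<Rightarrow> real) \<Rightarrow> (real \<Rightarrow> real ^ 'n ^ 'n) \<Rightarrow> (real \<Rightarrow> real ^ 'n \<Rightarrow> real ^ 'n) \<Rightarrow>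
     (real \<Rightarrow> real ^ 'n \<Rightarrow> real ^ 'n) \<Rightarrow> bool" where
  "equivalent_function N A f H \<longleftrightarrow>
     (\<forall>t. homeomorphism UNIV UNIV (H t) (inv (H t))) \<and>
     (\<exists>C. \<forall>t x. N (H t x - x) \<le> C) \<and>
     (\<exists>C. \<forall>t y. N (inv (H t) y - y) \<le> C) \<and>
     (\<forall>x. solution (nonlin_field A f) x \<longrightarrow> solution (lin_field A) (\<lambda>t. H t (x t))) \<and>
     (\<forall>y. solution (lin_field A) y \<longrightarrow> solution (nonlin_field A f) (\<lambda>t. inv (H t) (y t)))"

end

theory Submission
  imports Defs
begin

text \<open>
  Let \<open>T k t\<close>, written \<open>green_op k t\<close> in the code, be the integral of \<open>G(t,s) k(s)\<close> over all \<open>s\<close>.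
  The trichotomy gives \<open>\<bar>G(t,s)\<bar> \<le> \<beta> exp(- \<alpha> \<bar>t - s\<bar>)\<close>, so \<open>T\<close> maps a continuous \<open>k\<close> with
  \<open>\<bar>k\<bar> \<le> B\<close> to a function bounded by \<open>2 \<beta> B / \<alpha>\<close>. The kernel \<open>U(t)\<^sup>-\<^sup>1 G(t,s)\<close> jumps by \<open>U(s)\<^sup>-\<^sup>1\<close>
  when \<open>t\<close> passes \<open>s\<close> and is otherwise constant in \<open>t\<close>, whence \<open>z = T k\<close> solves \<open>z' = A z + k\<close>
  (\<open>green_op_deriv\<close>).

  For a linear solution \<open>y\<close>, the map \<open>z \<mapsto> T (f (\<cdot>, y + z))\<close> contracts with factor \<open>2 \<beta> \<gamma> / \<alpha> < 1\<close>.
  Its fixed point \<open>z\<close>, the limit of the Picard iterates from \<open>0\<close>, is bounded by \<open>2 \<beta> \<mu> / \<alpha>\<close>, and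
  \<open>y + z\<close> solves the nonlinear system. The map \<open>\<L>(t,\<cdot>)\<close> sends the value \<open>y(t)\<close> to \<open>y(t) + z(t)\<close>. It
  is called \<open>lift t\<close> here, and \<open>\<H>(t,\<cdot>)\<close> is its inverse.

  Hoelder continuity of \<open>\<L>\<close> is an invariant of the Picard iteration (\<open>picard_diff_le\<close>): if two
  iterates differ at every time \<open>s\<close> by at most \<open>p \<bar>y(s) - y'(s)\<bar>\<^sup>q\<close>, then interpolation between the
  bound \<open>2 \<mu>\<close> and the Lipschitz bound for \<open>f\<close> shows that the forcing terms differ by at most
  \<open>m (1 + p) \<bar>y(s) - y'(s)\<bar>\<^sup>q \<le> m (1 + p) \<Delta>\<^sub>1(s,t)\<^sup>q \<bar>y(t) - y'(t)\<bar>\<^sup>q\<close>, and the weighted integral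
  of \<open>G\<close> turns the factor \<open>1 + p\<close> into \<open>p\<close> again.

  The map \<open>\<L>(t,\<cdot>)\<close> is continuous and at bounded distance from the identity, hence onto by
  Brouwer's theorem (\<open>lift_surj\<close>); in particular a nonlinear solution passes through every point.
  By \<open>\<Delta>\<^sub>2\<close> this solution \<open>x\<close> is unique, and the fixed point equation recovers the linear solution as
  \<open>y(t) = x(t) - T (f (\<cdot>, x)) t\<close>. This proves injectivity and gives a formula for \<open>\<H>\<close>, from which
  its Hoelder estimate follows directly with the weight \<open>\<Delta>\<^sub>2\<close>.
\<close>

section \<open>Norms on a Euclidean space\<close>

lemma convex_on_sublinear:
  fixes g :: "'a::real_vector \<Rightarrow> real"
  assumes "\<And>x y. g (x + y) \<le> g x + g y" and "\<And>c x. g (c *\<^sub>R x) = \<bar>c\<bar> * g x"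
  shows "convex_on UNIV g"
proof (rule convex_onI)
  fix t :: real and x y :: 'a
  assume "0 < t" "t < 1"
  then show "g ((1 - t) *\<^sub>R x + t *\<^sub>R y) \<le> (1 - t) * g x + t * g y"
    using assms(1)[of "(1 - t) *\<^sub>R x" "t *\<^sub>R y"] by (simp add: assms(2))
qed simp

locale norm_on =
  fixes N :: "'a::euclidean_space \<Rightarrow> real"
  assumes is_norm: "is_norm N"
begin

lemma N_eq_0_iff [simp]: "N x = 0 \<longleftrightarrow> x = 0"
  and N_triangle: "N (x + y) \<le> N x + N y"
  and N_scale: "N (c *\<^sub>R x) = \<bar>c\<bar> * N x"
  using is_norm by (auto simp: is_norm_def)

lemma N_zero [simp]: "N 0 = 0"
  by simp

lemma N_minus [simp]: "N (- x) = N x"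
  using N_scale[of "-1" x] by simp

lemma N_nonneg [simp]: "0 \<le> N x"
  using N_triangle[of x "- x"] by simp

lemma N_pos_iff [simp]: "0 < N x \<longleftrightarrow> x \<noteq> 0"
  using N_nonneg[of x] N_eq_0_iff[of x] by linarith

lemma N_minus_commute: "N (x - y) = N (y - x)"
  using N_minus[of "x - y"] by simp

lemma N_triangle_minus: "N (x - y) \<le> N x + N y"
  using N_triangle[of x "- y"] by simp

lemma N_convex: "convex_on UNIV N"
  by (rule convex_on_sublinear) (auto simp: N_triangle N_scale)

lemma N_continuous: "continuous_on S N"
  using convex_on_continuous[OF open_UNIV N_convex] continuous_on_subset by blast

lemma N_tendsto: "(g \<longlongrightarrow> l) F \<Longrightarrow> ((\<lambda>x. N (g x)) \<longlongrightarrow> N l) F"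
  using N_continuous[of UNIV]
  by (metis UNIV_I continuous_on_eq_continuous_within isCont_tendsto_compose)

lemma N_measurable [measurable]: "N \<in> borel_measurable borel"
  by (rule borel_measurable_continuous_onI) (rule N_continuous)

lemma norm_le_N: obtains c where "c > 0" and "\<And>x. norm x \<le> c * N x"
proof -
  obtain d where d: "0 < d" "\<forall>x\<in>sphere 0 1. d \<le> norm (N x)"
    using brouwer_compactness_lemma[of "sphere 0 1" N] N_continuous by auto
  have "norm x \<le> inverse d * N x" for x
  proof (cases "x = 0")
    case False
    then have "d \<le> N (x /\<^sub>R norm x)"
      using d(2) by auto
    then show ?thesis
      using False d(1) by (simp add: N_scale field_simps)
  qed simp
  then show thesis
    using that[of "inverse d"] d(1) by simp
qed

lemma N_le_norm: obtains C where "C > 0" and "\<And>x. N x \<le> C * norm x"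
proof -
  have "bounded (N ` sphere 0 1)"
    by (intro compact_imp_bounded compact_continuous_image N_continuous) auto
  then obtain C where C: "C > 0" "\<forall>x\<in>sphere 0 1. norm (N x) \<le> C"
    by (auto simp: bounded_pos)
  have "N x \<le> C * norm x" for x
  proof (cases "x = 0")
    case False
    then have "N (x /\<^sub>R norm x) \<le> C"
      using C(2) by auto
    then show ?thesis
      using False by (simp add: N_scale field_simps)
  qed simp
  then show thesis
    using that[of C] C(1) by simp
qed

text \<open>
  If the bound failed, a hyperplane would separate the integral from an \<open>N\<close>-ball that is too small to
  contain it. Integrating the linear inequality that defines the half-space gives a contradiction.
\<close>

lemma N_integral_le:
  assumes "integrable M v"
  shows "integrable M (\<lambda>s. N (v s))" and "N (\<integral>s. v s \<partial>M) \<le> (\<integral>s. N (v s) \<partial>M)"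
proof -
  obtain C where C: "C > 0" "\<And>x. N x \<le> C * norm x"
    using N_le_norm by blast
  show int: "integrable M (\<lambda>s. N (v s))"
  proof (rule Bochner_Integration.integrable_bound)
    show "integrable M (\<lambda>s. C * norm (v s))"
      using assms by simp
    show "(\<lambda>s. N (v s)) \<in> borel_measurable M"
      using assms by (auto intro: measurable_compose[OF _ N_measurable])
  qed (use C in \<open>auto simp: abs_of_pos\<close>)
  let ?w = "\<integral>s. v s \<partial>M" and ?I = "\<integral>s. N (v s) \<partial>M"
  show "N ?w \<le> ?I"
  proof (rule ccontr)
    assume "\<not> N ?w \<le> ?I"
    \<comment> \<open>Scaling by some \<open>r\<close> strictly in between reduces to the unit ball, also when \<open>?I = 0\<close>.\<close>
    then obtain r where r: "?I < r" "r < N ?w"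
      using dense by (meson not_le)
    have "0 \<le> ?I"
      by (simp add: integral_nonneg_AE)
    then have "r > 0"
      using r by linarith
    have "convex {x. N x \<le> 1}"
    proof (rule convexI)
      fix x y and u v :: real
      assume *: "x \<in> {x. N x \<le> 1}" "y \<in> {x. N x \<le> 1}" "0 \<le> u" "0 \<le> v" "u + v = 1"
      then have "N (u *\<^sub>R x + v *\<^sub>R y) \<le> u * N x + v * N y"
        using N_triangle[of "u *\<^sub>R x" "v *\<^sub>R y"] by (simp add: N_scale)
      also have "\<dots> \<le> 1"
        using * by (intro convex_bound_le) auto
      finally show "u *\<^sub>R x + v *\<^sub>R y \<in> {x. N x \<le> 1}"
        by simp
    qed
    moreover have "closed {x. N x \<le> 1}"
      by (intro closed_Collect_le N_continuous continuous_on_const)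
    moreover have "?w /\<^sub>R r \<notin> {x. N x \<le> 1}"
      using r \<open>r > 0\<close> by (simp add: N_scale field_simps)
    ultimately obtain a b where ab: "inner a (?w /\<^sub>R r) < b" "\<And>x. N x \<le> 1 \<Longrightarrow> b < inner a x"
      using separating_hyperplane_closed_point by (metis mem_Collect_eq)
    have "b < 0"
      using ab(2)[of 0] by simp
    have lower: "b * N x \<le> inner a x" for x
    proof (cases "x = 0")
      case False
      then show ?thesis
        using ab(2)[of "x /\<^sub>R N x"] by (simp add: N_scale field_simps)
    qed simp
    have "b * ?I = (\<integral>s. b * N (v s) \<partial>M)"
      by simp
    also have "\<dots> \<le> (\<integral>s. inner a (v s) \<partial>M)"
      using assms int by (intro integral_mono lower) auto
    also have "\<dots> = inner a ?w"
      using assms by simp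
    also have "\<dots> < b * r"
      using ab(1) \<open>r > 0\<close> by (simp add: field_simps)
    finally show False
      using r(1) \<open>b < 0\<close> by simp
  qed
qed

lemma N_uniform_limitD:
  assumes "uniform_limit S F g sequentially" "e > 0"
  shows "\<forall>\<^sub>F n in sequentially. \<forall>x\<in>S. N (F n x - g x) < e"
proof -
  obtain C where C: "C > 0" "\<And>x. N x \<le> C * norm x"
    using N_le_norm by blast
  have "\<forall>\<^sub>F n in sequentially. \<forall>x\<in>S. dist (F n x) (g x) < e / C"
    using assms C(1) by (intro uniform_limitD) auto
  then show ?thesis
  proof eventually_elim
    case (elim n)
    have "N (F n x - g x) < e" if "x \<in> S" for x
      using elim that C(1) C(2)[of "F n x - g x"]
      by (fastforce simp: dist_norm field_simps intro: order_le_less_trans)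
    then show ?case
      by blast
  qed
qed

lemma N_tendstoI:
  assumes "\<And>e. e > 0 \<Longrightarrow> \<forall>\<^sub>F n in F. N (x n - l) < e"
  shows "(x \<longlongrightarrow> l) F"
proof (rule tendstoI)
  obtain c where c: "c > 0" "\<And>x. norm x \<le> c * N x"
    using norm_le_N by blast
  fix e :: real
  assume "e > 0"
  then have "\<forall>\<^sub>F n in F. N (x n - l) < e / c"
    using c(1) by (intro assms) auto
  then show "\<forall>\<^sub>F n in F. dist (x n) l < e"
    by eventually_elim
      (use c in \<open>fastforce simp: dist_norm field_simps intro: order_le_less_trans\<close>)
qed

lemma holder_imp_continuous:
  assumes holder: "\<And>x y. N (x - y) < 1 \<Longrightarrow> N (h x - h y) \<le> c * N (x - y) powr q" and "q > 0"
  shows "continuous_on UNIV h"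
proof (rule continuous_at_imp_continuous_on, rule ballI)
  fix a
  have N0: "((\<lambda>x. N (x - a)) \<longlongrightarrow> 0) (at a)"
    using N_tendsto[of "\<lambda>x. x - a" 0 "at a"] by (simp add: LIM_zero)
  then have "((\<lambda>x. c * N (x - a) powr q) \<longlongrightarrow> c * 0) (at a)"
    using \<open>q > 0\<close> by (intro tendsto_mult_left tendsto_zero_powrI tendsto_const) auto
  then have "\<forall>\<^sub>F x in at a. c * N (x - a) powr q < e" if "e > 0" for e
    using that by (intro order_tendstoD(2)) auto
  moreover have "\<forall>\<^sub>F x in at a. N (x - a) < 1"
    using N0 by (intro order_tendstoD(2)) auto
  ultimately have "\<forall>\<^sub>F x in at a. N (h x - h a) < e" if "e > 0" for e
    using that
    by (smt (verit, ccfv_threshold) eventually_elim2 holder)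
  then show "isCont h a"
    unfolding isCont_def by (rule N_tendstoI)
qed

end

text \<open>
  The induced operator norm is a supremum, so its continuity and measurability are not
  automatic. It is sublinear, hence convex, hence continuous in finite dimension.
\<close>

locale matrix_norm_on = norm_on N for N :: "real ^ 'n \<Rightarrow> real"
begin

lemma op_norm_bdd: "bdd_above (range (\<lambda>x. N (M *v x) / N x))"
proof -
  obtain c where c: "c > 0" "\<And>x. norm x \<le> c * N x"
    using norm_le_N by blast
  obtain C where C: "C > 0" "\<And>x. N x \<le> C * norm x"
    using N_le_norm by blast
  obtain K where K: "K > 0" "\<And>x. norm (M *v x) \<le> norm x * K"
    using bounded_linear.pos_bounded[OF matrix_vector_mul_bounded_linear] by blast
  have "N (M *v x) / N x \<le> C * K * c" for x
  proof -
    have "N (M *v x) \<le> C * (norm x * K)"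
      using C K(2)[of x] by (meson mult_le_cancel_left_pos order_trans)
    also have "\<dots> \<le> C * K * c * N x"
      using c(2)[of x] C(1) K(1) by (simp add: mult_ac)
    finally show ?thesis
      using c C K by (cases "x = 0") (auto simp: divide_le_eq mult_ac)
  qed
  then show ?thesis
    by (auto intro!: bdd_aboveI)
qed

lemma N_matrix_le: "N (M *v x) \<le> op_norm N M * N x"
proof (cases "x = 0")
  case False
  have "N (M *v x) / N x \<le> op_norm N M"
    unfolding op_norm_def by (rule cSUP_upper[OF _ op_norm_bdd]) simp
  then show ?thesis
    using False by (simp add: divide_le_eq)
qed simp

lemma op_norm_nonneg: "0 \<le> op_norm N M"
  unfolding op_norm_def by (rule cSUP_upper2[OF op_norm_bdd, of 0]) auto

lemma op_norm_le: "(\<And>x. N (M *v x) \<le> c * N x) \<Longrightarrow> 0 \<le> c \<Longrightarrow> op_norm N M \<le> c"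
  unfolding op_norm_def
  by (rule cSUP_least) (auto simp: divide_le_eq order_less_le)

lemma op_norm_continuous: "continuous_on S (op_norm N)"
proof -
  have scale_le: "op_norm N (c *\<^sub>R M) \<le> \<bar>c\<bar> * op_norm N M" for c M
    by (rule op_norm_le)
      (auto simp: op_norm_nonneg scaleR_matrix_vector_assoc[symmetric] N_scale mult.assoc
        intro!: mult_left_mono N_matrix_le)
  have "op_norm N (c *\<^sub>R M) = \<bar>c\<bar> * op_norm N M" for c M
  proof (cases "c = 0")
    case True
    then show ?thesis using scale_le[of 0 M] op_norm_nonneg[of 0] by simp
  next
    case False
    then show ?thesis
      using scale_le[of c M] scale_le[of "inverse c" "c *\<^sub>R M"] by (simp add: field_simps)
  qed
  moreover have "op_norm N (M + M') \<le> op_norm N M + op_norm N M'" for M M'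
  proof (rule op_norm_le)
    fix x
    show "N ((M + M') *v x) \<le> (op_norm N M + op_norm N M') * N x"
      using N_triangle[of "M *v x" "M' *v x"] N_matrix_le[of M x] N_matrix_le[of M' x]
      by (simp add: matrix_vector_mult_add_rdistrib distrib_right)
  qed (simp add: op_norm_nonneg)
  ultimately have "convex_on UNIV (op_norm N)"
    by (intro convex_on_sublinear) auto
  then show ?thesis
    using convex_on_continuous[OF open_UNIV] continuous_on_subset by blast
qed

lemma op_norm_measurable [measurable]: "op_norm N \<in> borel_measurable borel"
  by (rule borel_measurable_continuous_onI) (rule op_norm_continuous)

end

section \<open>Matrix-valued functions\<close>

lemma bounded_bilinear_matrix_vector:
  "bounded_bilinear ((*v) :: real ^ 'n ^ 'm \<Rightarrow> real ^ 'n \<Rightarrow> real ^ 'm)"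
proof -
  have "bilinear ((*v) :: real ^ 'n ^ 'm \<Rightarrow> real ^ 'n \<Rightarrow> real ^ 'm)"
    by (auto simp: bilinear_def intro!: linearI
        simp: matrix_vector_mult_add_rdistrib scaleR_matrix_vector_assoc[symmetric])
  then show ?thesis
    by (simp add: bilinear_conv_bounded_bilinear)
qed

lemmas continuous_on_matrix_vector [continuous_intros] =
  bounded_bilinear.continuous_on[OF bounded_bilinear_matrix_vector]

lemma continuous_on_matrix_matrix [continuous_intros]:
  fixes F :: "'a::topological_space \<Rightarrow> real ^ 'n ^ 'm" and G :: "'a \<Rightarrow> real ^ 'k ^ 'n"
  assumes "continuous_on S F" "continuous_on S G"
  shows "continuous_on S (\<lambda>s. F s ** G s)"
  unfolding matrix_matrix_mult_def using assms by (intro continuous_intros)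

lemma measurable_matrix_vector [measurable (raw)]:
  fixes F :: "'a \<Rightarrow> real ^ 'n ^ 'm" and g :: "'a \<Rightarrow> real ^ 'n"
  assumes "F \<in> borel_measurable M" "g \<in> borel_measurable M"
  shows "(\<lambda>s. F s *v g s) \<in> borel_measurable M"
  using assms
  by (rule borel_measurable_continuous_Pair) (intro continuous_intros)

lemma matrix_inv_inverse:
  fixes M :: "real ^ 'n ^ 'n"
  assumes "invertible M"
  shows "M ** matrix_inv M = mat 1" "matrix_inv M ** M = mat 1"
  using someI_ex[OF assms[unfolded invertible_def]] unfolding matrix_inv_def by auto

lemma continuous_on_det:
  fixes F :: "'a::topological_space \<Rightarrow> real ^ 'n ^ 'n"
  assumes "continuous_on S F"
  shows "continuous_on S (\<lambda>s. det (F s))"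
  unfolding det_def using assms by (intro continuous_intros)

text \<open>
  By Cramer's rule the entries of the inverse are quotients of determinants.
\<close>

lemma continuous_on_matrix_inv:
  fixes F :: "'a::topological_space \<Rightarrow> real ^ 'n ^ 'n"
  assumes "continuous_on S F" and inv: "\<And>s. s \<in> S \<Longrightarrow> invertible (F s)"
  shows "continuous_on S (\<lambda>s. matrix_inv (F s))"
proof -
  let ?C = "\<lambda>s l k. (\<chi> i j. if j = k then axis l 1 $ i else F s $ i $ j) :: real ^ 'n ^ 'n"
  have entry: "matrix_inv (F s) = (\<chi> k l. det (?C s l k) / det (F s))" if "s \<in> S" for s
  proof -
    have nz: "det (F s) \<noteq> 0"
      using inv[OF that] by (simp add: invertible_det_nz)
    have "F s *v (matrix_inv (F s) *v axis l 1) = axis l 1" for l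
      using matrix_inv_inverse(1)[OF inv[OF that]] by (simp add: matrix_vector_mul_assoc)
    then have "matrix_inv (F s) *v axis l 1 = (\<chi> k. det (?C s l k) / det (F s))" for l
      using cramer[OF nz] by blast
    then have "matrix_inv (F s) $ k $ l = det (?C s l k) / det (F s)" for k l
      by (simp add: matrix_vector_mult_basis column_def vec_eq_iff)
    then show ?thesis
      by (simp add: vec_eq_iff)
  qed
  have "continuous_on S (\<lambda>s. if j = k then axis l 1 $ i else F s $ i $ j)" for i j k l
    using assms(1) by (cases "j = k") (auto intro!: continuous_intros)
  then have "continuous_on S (\<lambda>s. (\<chi> k l. det (?C s l k) / det (F s)) :: real ^ 'n ^ 'n)"
    using assms(1) inv
    by (intro continuous_on_vec_lambda continuous_on_divide continuous_on_det)
      (auto simp: invertible_det_nz)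
  then show ?thesis
    by (subst continuous_on_cong[OF refl entry])
qed

section \<open>The Green operator\<close>

text \<open>
  The integrand is at most the sum of its two branches, which are mirror images under
  \<open>s \<mapsto> 2 t - s\<close> and contribute \<open>1 / \<alpha>\<close> each.
\<close>

lemma nn_integral_exp_abs_le:
  fixes \<alpha> t :: real
  assumes "\<alpha> > 0"
  shows "(\<integral>\<^sup>+ s. ennreal (exp (- \<alpha> * \<bar>t - s\<bar>)) \<partial>lborel) \<le> ennreal (2 / \<alpha>)"
proof -
  let ?E = "\<lambda>s. exp (- \<alpha> * (s - t))"
  have "((\<lambda>s. - ?E s / \<alpha>) \<longlongrightarrow> 0) at_top"
  proof -
    have "filterlim (\<lambda>s. - \<alpha> * (s - t)) at_bot at_top"
      using assms filterlim_tendsto_neg_mult_at_bot[OF tendsto_const, of "- \<alpha>",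
          OF _ filterlim_tendsto_add_at_top[OF tendsto_const[of "- t"] filterlim_ident]]
      by simp
    then have "(?E \<longlongrightarrow> 0) at_top"
      by (rule filterlim_compose[OF exp_at_bot])
    from tendsto_divide[OF tendsto_minus[OF this] tendsto_const, of \<alpha>] show ?thesis
      using assms by simp
  qed
  moreover have "((\<lambda>s. - ?E s / \<alpha>) has_real_derivative ?E s) (at s)" for s
    using assms by (auto intro!: derivative_eq_intros)
  ultimately have "(\<integral>\<^sup>+ s. ennreal (?E s) * indicator {t..} s \<partial>lborel) = ennreal (0 - - ?E t / \<alpha>)"
    by (intro nn_integral_FTC_atLeast) auto
  then have right: "(\<integral>\<^sup>+ s. ennreal (?E s) * indicator {t..} s \<partial>lborel) = ennreal (1 / \<alpha>)"
    by simp
  have "(\<integral>\<^sup>+ s. ennreal (exp (- \<alpha> * \<bar>t - s\<bar>)) \<partial>lborel)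
      \<le> (\<integral>\<^sup>+ s. ennreal (?E s) * indicator {t..} s + ennreal (?E (2 * t - s)) * indicator {t..} (2 * t - s) \<partial>lborel)"
    by (intro nn_integral_mono) (auto simp: indicator_def abs_if)
  also have "\<dots> = (\<integral>\<^sup>+ s. ennreal (?E s) * indicator {t..} s \<partial>lborel)
      + (\<integral>\<^sup>+ s. ennreal (?E (2 * t - s)) * indicator {t..} (2 * t - s) \<partial>lborel)"
    by (intro nn_integral_add) auto
  also have "(\<integral>\<^sup>+ s. ennreal (?E (2 * t - s)) * indicator {t..} (2 * t - s) \<partial>lborel)
      = (\<integral>\<^sup>+ s. ennreal (?E s) * indicator {t..} s \<partial>lborel)"
    by (subst nn_integral_real_affine[where c = "-1" and t = "2 * t" and 
          f = "\<lambda>s. ennreal (?E s) * indicator {t..} s"]) auto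
  also have "(\<integral>\<^sup>+ s. ennreal (?E s) * indicator {t..} s \<partial>lborel)
      + (\<integral>\<^sup>+ s. ennreal (?E s) * indicator {t..} s \<partial>lborel) = ennreal (2 / \<alpha>)"
    unfolding right using assms by (simp flip: ennreal_plus)
  finally show ?thesis .
qed

locale trichotomy = matrix_norm_on N for N :: "real ^ 'n \<Rightarrow> real" +
  fixes A U :: "real \<Rightarrow> real ^ 'n ^ 'n" and P Q :: "real ^ 'n ^ 'n" and \<beta> \<alpha> :: real
  assumes fundamental: "fundamental_matrix A U"
    and trichotomy: "exponential_trichotomy N U P Q \<beta> \<alpha>"
begin

abbreviation "V s \<equiv> matrix_inv (U s)"
abbreviation "G \<equiv> green U P Q"

lemma beta_ge_1: "1 \<le> \<beta>" and alpha_pos: "0 < \<alpha>"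
  using trichotomy by (auto simp: exponential_trichotomy_def)

lemma U_deriv: "(U has_vector_derivative A t ** U t) (at t)"
  and U_inverse: "U t ** V t = mat 1" "V t ** U t = mat 1"
  using fundamental by (auto simp: fundamental_matrix_def matrix_inv_inverse)

lemma U_continuous: "continuous_on S U"
  by (rule continuous_at_imp_continuous_on) (blast intro: has_vector_derivative_continuous U_deriv)

lemma V_continuous: "continuous_on S V"
  using fundamental
  by (intro continuous_on_matrix_inv U_continuous) (auto simp: fundamental_matrix_def)

lemma V_measurable [measurable]: "V \<in> borel_measurable borel"
  by (rule borel_measurable_continuous_onI) (rule V_continuous)

lemma G_measurable [measurable]: "G t \<in> borel_measurable borel"
proof -
  have [measurable]: "(\<lambda>s. M ** V s) \<in> borel_measurable borel" for M :: "real ^ 'n ^ 'n"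
    by (intro borel_measurable_continuous_onI continuous_intros V_continuous)
  show ?thesis
    unfolding green_def by measurable
qed

lemma op_norm_uminus: "op_norm N (- M) = op_norm N M"
proof -
  have "- M *v x = - (M *v x)" for x
    using scaleR_matrix_vector_assoc[of "-1" M x] by simp
  then show ?thesis
    by (simp add: op_norm_def)
qed

text \<open>
  Each of the four regions in the definition of the Green function carries its own estimate, and
  in each of them the exponent is \<open>- \<alpha> \<bar>t - s\<bar>\<close>.
\<close>

lemma G_le: "op_norm N (G t s) \<le> \<beta> * exp (- \<alpha> * \<bar>t - s\<bar>)"
proof -
  have "0 \<le> s \<Longrightarrow> s \<le> t \<Longrightarrow> op_norm N (U t ** P ** V s) \<le> \<beta> * exp (- \<alpha> * (t - s))"
    and "0 \<le> s \<Longrightarrow> t \<le> s \<Longrightarrow> op_norm N (U t ** (mat 1 - P) ** V s) \<le> \<beta> * exp (- \<alpha> * (s - t))"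
    and "s \<le> 0 \<Longrightarrow> t \<le> s \<Longrightarrow> op_norm N (U t ** Q ** V s) \<le> \<beta> * exp (- \<alpha> * (s - t))"
    and "s \<le> 0 \<Longrightarrow> s \<le> t \<Longrightarrow> op_norm N (U t ** (mat 1 - Q) ** V s) \<le> \<beta> * exp (- \<alpha> * (t - s))"
    using trichotomy by (simp_all add: exponential_trichotomy_def)
  then show ?thesis
    by (cases s t rule: linorder_cases; cases "0 \<le> s") (simp_all add: green_def op_norm_uminus)
qed

definition green_op :: "(real \<Rightarrow> real ^ 'n) \<Rightarrow> real \<Rightarrow> real ^ 'n" where
  "green_op k t = (\<integral>s. G t s *v k s \<partial>lborel)"

lemma N_G_nn_integral_le:
  assumes "\<And>s. N (k s) \<le> B"
  shows "(\<integral>\<^sup>+ s. ennreal (N (G t s *v k s)) \<partial>lborel) \<le> ennreal (2 * \<beta> / \<alpha> * B)"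
proof -
  have B: "0 \<le> B"
    using assms[of 0] N_nonneg[of "k 0"] by linarith
  have "N (G t s *v k s) \<le> \<beta> * B * exp (- \<alpha> * \<bar>t - s\<bar>)" for s
  proof -
    have "N (G t s *v k s) \<le> op_norm N (G t s) * N (k s)"
      by (rule N_matrix_le)
    also have "\<dots> \<le> (\<beta> * exp (- \<alpha> * \<bar>t - s\<bar>)) * B"
      using beta_ge_1 by (intro mult_mono G_le assms) auto
    finally show ?thesis
      by (simp add: mult_ac)
  qed
  then have "(\<integral>\<^sup>+ s. ennreal (N (G t s *v k s)) \<partial>lborel)
      \<le> (\<integral>\<^sup>+ s. ennreal (\<beta> * B) * ennreal (exp (- \<alpha> * \<bar>t - s\<bar>)) \<partial>lborel)"
    using B beta_ge_1 by (intro nn_integral_mono) (auto simp: ennreal_mult[symmetric])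
  also have "\<dots> = ennreal (\<beta> * B) * (\<integral>\<^sup>+ s. ennreal (exp (- \<alpha> * \<bar>t - s\<bar>)) \<partial>lborel)"
    by (rule nn_integral_cmult) simp
  also have "\<dots> \<le> ennreal (\<beta> * B) * ennreal (2 / \<alpha>)"
    by (intro mult_left_mono nn_integral_exp_abs_le alpha_pos) auto
  finally show ?thesis
    using B beta_ge_1 alpha_pos by (simp add: ennreal_mult[symmetric] field_simps)
qed

lemma G_integrable:
  assumes "continuous_on UNIV k" "\<And>s. N (k s) \<le> B"
  shows "integrable lborel (\<lambda>s. G t s *v k s)"
proof -
  have [measurable]: "k \<in> borel_measurable borel"
    using assms(1) by (rule borel_measurable_continuous_onI)
  obtain c where c: "c > 0" "\<And>x. norm x \<le> c * N x"
    using norm_le_N by blast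
  have "(\<integral>\<^sup>+ s. ennreal (norm (G t s *v k s)) \<partial>lborel)
      \<le> (\<integral>\<^sup>+ s. ennreal c * ennreal (N (G t s *v k s)) \<partial>lborel)"
    using c by (intro nn_integral_mono) (auto simp: ennreal_mult[symmetric])
  also have "\<dots> = ennreal c * (\<integral>\<^sup>+ s. ennreal (N (G t s *v k s)) \<partial>lborel)"
    by (rule nn_integral_cmult) measurable
  also have "\<dots> \<le> ennreal c * ennreal (2 * \<beta> / \<alpha> * B)"
    by (intro mult_left_mono N_G_nn_integral_le assms(2)) simp
  also have "\<dots> < \<infinity>"
    by (simp add: ennreal_mult_less_top)
  finally show ?thesis
    by (intro integrableI_bounded) auto
qed

lemma green_op_nn_le:
  assumes "continuous_on UNIV k" "\<And>s. N (k s) \<le> B"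
  shows "ennreal (N (green_op k t)) \<le> (\<integral>\<^sup>+ s. ennreal (N (G t s *v k s)) \<partial>lborel)"
  using N_integral_le[OF G_integrable[OF assms]]
  by (simp add: green_op_def nn_integral_eq_integral)

lemma green_op_le:
  assumes "continuous_on UNIV k" "\<And>s. N (k s) \<le> B"
  shows "N (green_op k t) \<le> 2 * \<beta> / \<alpha> * B"
proof -
  have "0 \<le> B"
    using assms(2)[of 0] N_nonneg[of "k 0"] by linarith
  then show ?thesis
    using order_trans[OF green_op_nn_le[OF assms] N_G_nn_integral_le[OF assms(2)]]
      beta_ge_1 alpha_pos by (simp add: ennreal_le_iff)
qed

lemma green_op_diff:
  assumes "continuous_on UNIV k" "\<And>s. N (k s) \<le> B"
    and "continuous_on UNIV k'" "\<And>s. N (k' s) \<le> B'"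
  shows "green_op k t - green_op k' t = green_op (\<lambda>s. k s - k' s) t"
  unfolding green_op_def
  by (simp add: G_integrable[OF assms(1,2)] G_integrable[OF assms(3,4)] algebra_simps
      flip: Bochner_Integration.integral_diff)

text \<open>
  Pulling the Green function back by \<open>U(t)\<^sup>-\<^sup>1\<close> removes its dependence on \<open>t\<close> except for the side of
  \<open>s\<close> on which \<open>t\<close> lies: the projection in front of \<open>U(s)\<^sup>-\<^sup>1\<close> is \<open>P\<close> or \<open>P - I\<close> for \<open>s \<ge> 0\<close> and
  \<open>I - Q\<close> or \<open>- Q\<close> for \<open>s < 0\<close>, and in both cases the two values differ by \<open>I\<close>.
\<close>

lemma V_G_diff:
  assumes "a \<le> t" "s \<noteq> a" "s \<noteq> t"
  shows "V t ** G t s - V a ** G a s = indicator {a..t} s *\<^sub>R V s"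
proof -
  define X where "X t s = (if 0 \<le> s then (if s \<le> t then P else P - mat 1)
    else (if t \<le> s then - Q else mat 1 - Q))" for t s :: real
  have cancel: "V t ** (U t ** M ** V s) = M ** V s" for t s and M :: "real ^ 'n ^ 'n"
    by (simp add: matrix_mul_assoc U_inverse)
  have minus_right: "M ** (- K) = - (M ** K)" for M K :: "real ^ 'n ^ 'n"
    by (simp add: vec_eq_iff matrix_matrix_mult_def sum_negf)
  have minus_left: "- (M ** K) = (- M) ** K" for M K :: "real ^ 'n ^ 'n"
    by (simp add: vec_eq_iff matrix_matrix_mult_def sum_negf)
  have VG: "V t ** G t s = X t s ** V s" for t
    using minus_left[of "mat 1 - P"] 
    by (auto simp: green_def X_def cancel minus_right minus_left[of Q])
  have "X t s ** V s - X a s ** V s = (X t s - X a s) ** V s"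
    by (simp add: vec_eq_iff matrix_matrix_mult_def algebra_simps sum_subtractf)
  also have "X t s - X a s = (if s \<in> {a..t} then mat 1 else 0)"
    using assms by (auto simp: X_def)
  finally show ?thesis
    by (simp add: VG indicator_def)
qed

text \<open>
  Variation of constants: by \<open>V_G_diff\<close>, \<open>U(t)\<^sup>-\<^sup>1 T k t\<close> is a primitive of \<open>U(s)\<^sup>-\<^sup>1 k(s)\<close>.
\<close>

lemma green_op_deriv:
  assumes k: "continuous_on UNIV k" "\<And>s. N (k s) \<le> B"
  shows "(green_op k has_vector_derivative A t *v green_op k t + k t) (at t)"
proof -
  define W where "W t = V t *v green_op k t" for t
  \<comment> \<open>Any base point to the left of \<open>t\<close> serves.\<close>
  define a where "a = t - 1"
  have green_op: "green_op k = (\<lambda>t. U t *v W t)"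
    by (simp add: W_def matrix_vector_mul_assoc U_inverse fun_eq_iff)
  have W: "W r = (\<integral>s. (V r ** G r s) *v k s \<partial>lborel)" for r
    unfolding W_def green_op_def
    by (simp add: matrix_vector_mul_assoc[symmetric]
        integral_bounded_linear[OF matrix_vector_mul_bounded_linear G_integrable[OF k]])
  have int: "integrable lborel (\<lambda>s. (V r ** G r s) *v k s)" for r
    using integrable_bounded_linear[OF matrix_vector_mul_bounded_linear G_integrable[OF k]]
    by (simp add: matrix_vector_mul_assoc)
  have Vk: "continuous_on S (\<lambda>s. V s *v k s)" for S
    using k(1) by (intro continuous_intros V_continuous) (rule continuous_on_subset, auto)
  have W_eq: "W a + integral {a..r} (\<lambda>s. V s *v k s) = W r" if "a \<le> r" for r
  proof -
    have "W r - W a = (\<integral>s. (V r ** G r s - V a ** G a s) *v k s \<partial>lborel)"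
      by (simp add: W int matrix_vector_mult_diff_rdistrib)
    also have "\<dots> = (LINT s : {a..r} | lborel. V s *v k s)"
      unfolding set_lebesgue_integral_def
    proof (rule integral_cong_AE)
      have [measurable]: "k \<in> borel_measurable borel"
        using k(1) by (rule borel_measurable_continuous_onI)
      show "(\<lambda>s. indicator {a..r} s *\<^sub>R (V s *v k s)) \<in> borel_measurable lborel"
        by measurable
      show "(\<lambda>s. (V r ** G r s - V a ** G a s) *v k s) \<in> borel_measurable lborel"
        using Bochner_Integration.integrable_diff[OF int int]
        by (simp add: matrix_vector_mult_diff_rdistrib borel_measurable_integrable)
      show "AE s in lborel. (V r ** G r s - V a ** G a s) *v k s = indicator {a..r} s *\<^sub>R (V s *v k s)"
        using AE_lborel_singleton[of a] AE_lborel_singleton[of r]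
        by eventually_elim (simp add: V_G_diff[OF that] scaleR_matrix_vector_assoc)
    qed
    also have "\<dots> = integral {a..r} (\<lambda>s. V s *v k s)"
      by (intro set_borel_integral_eq_integral borel_integrable_atLeastAtMost') (rule Vk)
    finally show ?thesis
      by (simp add: algebra_simps)
  qed
  have "((\<lambda>r. W a + integral {a..r} (\<lambda>s. V s *v k s)) has_vector_derivative V t *v k t)
      (at t within {a..t + 1})"
    using has_vector_derivative_add[OF has_vector_derivative_const
        integral_has_vector_derivative[OF Vk[of "{a..t + 1}"], of t], of "W a"]
    by (simp add: a_def)
  then have "(W has_vector_derivative V t *v k t) (at t within {a..t + 1})"
    by (rule has_vector_derivative_transform[rotated 2]) (auto simp: W_eq, simp add: a_def)
  then have "(W has_vector_derivative V t *v k t) (at t)"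
    by (simp add: a_def at_within_Icc_at)
  from bounded_bilinear.has_vector_derivative[OF bounded_bilinear_matrix_vector U_deriv this]
  have "((\<lambda>t. U t *v W t) has_vector_derivative U t *v (V t *v k t) + (A t ** U t) *v W t) (at t)" .
  moreover have "U t *v (V t *v k t) = k t"
    by (simp add: matrix_vector_mul_assoc U_inverse)
  moreover have "(A t ** U t) *v W t = A t *v green_op k t"
    by (simp add: W_def matrix_vector_mul_assoc U_inverse flip: matrix_mul_assoc)
  ultimately show ?thesis
    by (simp add: green_op[symmetric] add.commute)
qed

lemma green_op_continuous:
  assumes "continuous_on UNIV k" "\<And>s. N (k s) \<le> B"
  shows "continuous_on S (green_op k)"
  by (rule continuous_at_imp_continuous_on)
    (blast intro: has_vector_derivative_continuous green_op_deriv assms)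

lemma green_op_diff_le:
  assumes k: "continuous_on UNIV k" "\<And>s. N (k s) \<le> B"
    and k': "continuous_on UNIV k'" "\<And>s. N (k' s) \<le> B"
    and "\<And>s. N (k s - k' s) \<le> D"
  shows "N (green_op k t - green_op k' t) \<le> 2 * \<beta> / \<alpha> * D"
  unfolding green_op_diff[OF k k']
  using assms by (intro green_op_le continuous_on_diff)

text \<open>
  This is how the integral hypotheses on \<open>G\<close> lead to Hoelder estimates: a pointwise bound on the difference of two
  forcing terms by a multiple of the weight \<open>w\<close> becomes a bound on their images.
\<close>

lemma green_op_diff_le_weighted:
  assumes k: "continuous_on UNIV k" "\<And>s. N (k s) \<le> B"
    and k': "continuous_on UNIV k'" "\<And>s. N (k' s) \<le> B"
    and w: "w \<in> borel_measurable borel" "\<And>s. 0 \<le> w s"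
    and int: "ennreal m * (\<integral>\<^sup>+ s. ennreal (op_norm N (G t s) * w s) \<partial>lborel) \<le> ennreal \<theta>"
    and nonneg: "0 \<le> m" "0 \<le> c" "0 \<le> \<theta>"
    and diff: "\<And>s. N (k s - k' s) \<le> m * (c * w s)"
  shows "N (green_op k t - green_op k' t) \<le> c * \<theta>"
proof -
  note [measurable] = w(1)
  have kk': "continuous_on UNIV (\<lambda>s. k s - k' s)" "\<And>s. N (k s - k' s) \<le> B + B"
    using k(1) k'(1) order_trans[OF N_triangle_minus add_mono[OF k(2) k'(2)]]
    by (auto intro!: continuous_on_diff)
  have "ennreal (N (green_op k t - green_op k' t))
      \<le> (\<integral>\<^sup>+ s. ennreal (N (G t s *v (k s - k' s))) \<partial>lborel)"
    unfolding green_op_diff[OF k k'] by (rule green_op_nn_le[OF kk'])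
  also have "\<dots> \<le> (\<integral>\<^sup>+ s. ennreal (c * m) * ennreal (op_norm N (G t s) * w s) \<partial>lborel)"
  proof (rule nn_integral_mono)
    fix s
    have "N (G t s *v (k s - k' s)) \<le> op_norm N (G t s) * (m * (c * w s))"
      by (rule order_trans[OF N_matrix_le mult_left_mono[OF diff op_norm_nonneg]])
    then show "ennreal (N (G t s *v (k s - k' s))) \<le> ennreal (c * m) * ennreal (op_norm N (G t s) * w s)"
      using nonneg w(2) op_norm_nonneg by (simp add: mult_ac flip: ennreal_mult)
  qed
  also have "\<dots> = ennreal (c * m) * (\<integral>\<^sup>+ s. ennreal (op_norm N (G t s) * w s) \<partial>lborel)"
    by (rule nn_integral_cmult) measurable
  also have "\<dots> = ennreal c * (ennreal m * (\<integral>\<^sup>+ s. ennreal (op_norm N (G t s) * w s) \<partial>lborel))"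
    using nonneg by (simp add: ennreal_mult mult.assoc)
  also have "\<dots> \<le> ennreal c * ennreal \<theta>"
    by (intro mult_left_mono int) simp
  finally show ?thesis
    using nonneg by (simp flip: ennreal_mult)
qed

end

section \<open>Bounded corrections of linear solutions\<close>

text \<open>
  The constant \<open>2 \<beta> \<gamma> / \<alpha>\<close> is a Lipschitz constant of \<open>z \<mapsto> T (f (\<cdot>, y + z))\<close>, one \<open>\<beta> \<gamma> / \<alpha>\<close> for the
  integral over each side of \<open>t\<close>.
\<close>

locale perturbed_system = trichotomy N A U P Q \<beta> \<alpha>
  for N :: "real ^ 'n \<Rightarrow> real" and A U P Q \<beta> \<alpha> +
  fixes f :: "real \<Rightarrow> real ^ 'n \<Rightarrow> real ^ 'n" and \<mu> \<gamma> :: real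
  assumes f_continuous: "continuous_on UNIV (\<lambda>(t, x). f t x)"
    and f_le: "\<And>t x. N (f t x) \<le> \<mu>"
    and f_lipschitz: "\<And>t x y. N (f t x - f t y) \<le> \<gamma> * N (x - y)"
    and gamma_nonneg: "0 \<le> \<gamma>"
    and contraction: "2 * \<beta> / \<alpha> * \<gamma> < 1"
begin

lemma f_continuous_along: "continuous_on S y \<Longrightarrow> continuous_on S (\<lambda>s. f s (y s))"
  using continuous_on_compose2[OF f_continuous, of S "\<lambda>s. (s, y s)"]
  by (simp add: continuous_on_Pair)

lemma mu_nonneg: "0 \<le> \<mu>"
  using f_le[of 0 0] N_nonneg[of "f 0 0"] by linarith

fun picard :: "(real \<Rightarrow> real ^ 'n) \<Rightarrow> nat \<Rightarrow> real \<Rightarrow> real ^ 'n" where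
  "picard y 0 = (\<lambda>t. 0)"
| "picard y (Suc n) = green_op (\<lambda>s. f s (y s + picard y n s))"

text \<open>
  The limit of the Picard iterates, as a telescoping series so that the Weierstrass test yields
  uniform convergence.
\<close>

definition correction :: "(real \<Rightarrow> real ^ 'n) \<Rightarrow> real \<Rightarrow> real ^ 'n" where
  "correction y t = (\<Sum>i. picard y (Suc i) t - picard y i t)"

lemma picard_continuous: "continuous_on UNIV y \<Longrightarrow> continuous_on UNIV (picard y n)"
  by (induction n)
    (auto intro!: green_op_continuous f_continuous_along continuous_on_add f_le)

lemma picard_forcing_continuous:
  "continuous_on UNIV y \<Longrightarrow> continuous_on UNIV (\<lambda>s. f s (y s + picard y n s))"
  by (intro f_continuous_along continuous_on_add picard_continuous)

lemma picard_step_le: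
  assumes "continuous_on UNIV y"
  shows "N (picard y (Suc n) t - picard y n t) \<le> 2 * \<beta> / \<alpha> * \<mu> * (2 * \<beta> / \<alpha> * \<gamma>) ^ n"
proof (induction n arbitrary: t)
  case 0
  show ?case
    using green_op_le[OF picard_forcing_continuous[OF assms, of 0] f_le] by simp
next
  case (Suc n)
  let ?k = "\<lambda>n s. f s (y s + picard y n s)"
  have "N (?k (Suc n) s - ?k n s) \<le> \<gamma> * (2 * \<beta> / \<alpha> * \<mu> * (2 * \<beta> / \<alpha> * \<gamma>) ^ n)" for s
  proof -
    have "N (?k (Suc n) s - ?k n s) \<le> \<gamma> * N (picard y (Suc n) s - picard y n s)"
      using f_lipschitz[of s "y s + picard y (Suc n) s" "y s + picard y n s"] by simp
    also have "\<dots> \<le> \<gamma> * (2 * \<beta> / \<alpha> * \<mu> * (2 * \<beta> / \<alpha> * \<gamma>) ^ n)"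
      by (intro mult_left_mono Suc.IH gamma_nonneg)
    finally show ?thesis .
  qed
  from green_op_diff_le[OF picard_forcing_continuous[OF assms] f_le
      picard_forcing_continuous[OF assms] f_le this, of t]
  show ?case
    by (simp add: mult_ac)
qed

lemma picard_uniform_limit:
  assumes "continuous_on UNIV y"
  shows "uniform_limit UNIV (picard y) (correction y) sequentially"
proof -
  obtain c where c: "c > 0" "\<And>x. norm x \<le> c * N x"
    using norm_le_N by blast
  let ?M = "\<lambda>n. c * (2 * \<beta> / \<alpha> * \<mu> * (2 * \<beta> / \<alpha> * \<gamma>) ^ n)"
  have "norm (picard y (Suc n) t - picard y n t) \<le> ?M n" for n t
    using c picard_step_le[OF assms, of n t] by (meson mult_left_mono order_less_imp_le order_trans)
  moreover have "summable ?M"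
    using contraction gamma_nonneg beta_ge_1 alpha_pos
    by (intro summable_mult summable_geometric) auto
  ultimately have "uniform_limit UNIV (\<lambda>n t. \<Sum>i<n. picard y (Suc i) t - picard y i t)
      (\<lambda>t. \<Sum>i. picard y (Suc i) t - picard y i t) sequentially"
    by (rule Weierstrass_m_test)
  moreover have "(\<Sum>i<n. picard y (Suc i) t - picard y i t) = picard y n t" for n t
    by (subst sum_lessThan_telescope) simp
  ultimately show ?thesis
    by (simp add: correction_def[abs_def])
qed

lemma picard_tendsto: "continuous_on UNIV y \<Longrightarrow> (\<lambda>n. picard y n t) \<longlonglongrightarrow> correction y t"
  by (rule tendsto_uniform_limitI[OF picard_uniform_limit]) auto

lemma correction_continuous: "continuous_on UNIV y \<Longrightarrow> continuous_on UNIV (correction y)"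
  by (rule uniform_limit_theorem[OF always_eventually picard_uniform_limit])
    (auto intro: picard_continuous)

lemma correction_forcing_continuous:
  "continuous_on UNIV y \<Longrightarrow> continuous_on UNIV (\<lambda>s. f s (y s + correction y s))"
  by (intro f_continuous_along continuous_on_add correction_continuous)

lemma correction_fixed:
  assumes y: "continuous_on UNIV y"
  shows "green_op (\<lambda>s. f s (y s + correction y s)) t = correction y t"
proof -
  let ?\<kappa> = "2 * \<beta> / \<alpha> * \<gamma>"
  have "0 \<le> ?\<kappa>"
    using gamma_nonneg beta_ge_1 alpha_pos by simp
  have "(\<lambda>n. picard y (Suc n) t) \<longlonglongrightarrow> green_op (\<lambda>s. f s (y s + correction y s)) t"
  proof (rule N_tendstoI)
    fix e :: real
    assume "e > 0"
    from N_uniform_limitD[OF picard_uniform_limit[OF y] this]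
    show "\<forall>\<^sub>F n in sequentially.
        N (picard y (Suc n) t - green_op (\<lambda>s. f s (y s + correction y s)) t) < e"
    proof eventually_elim
      case (elim n)
      have "N (f s (y s + picard y n s) - f s (y s + correction y s)) \<le> \<gamma> * e" for s
      proof -
        have "N (f s (y s + picard y n s) - f s (y s + correction y s))
            \<le> \<gamma> * N (picard y n s - correction y s)"
          using f_lipschitz[of s "y s + picard y n s" "y s + correction y s"] by simp
        also have "\<dots> \<le> \<gamma> * e"
          using elim by (intro mult_left_mono gamma_nonneg) (auto intro: less_imp_le)
        finally show ?thesis .
      qed
      from green_op_diff_le[OF picard_forcing_continuous[OF y] f_le
          correction_forcing_continuous[OF y] f_le this, of t]
      have "N (picard y (Suc n) t - green_op (\<lambda>s. f s (y s + correction y s)) t) \<le> ?\<kappa> * e"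
        by (simp add: mult_ac)
      also have "\<dots> < 1 * e"
        using contraction \<open>e > 0\<close> by (intro mult_strict_right_mono)
      finally show ?case
        by simp
    qed
  qed
  then show ?thesis
    using LIMSEQ_unique LIMSEQ_Suc[OF picard_tendsto[OF y]] by blast
qed

lemma correction_le: "continuous_on UNIV y \<Longrightarrow> N (correction y t) \<le> 2 * \<beta> / \<alpha> * \<mu>"
  using green_op_le[OF correction_forcing_continuous f_le] by (simp add: correction_fixed)

lemma solution_continuous: "solution F y \<Longrightarrow> continuous_on S y"
  by (rule continuous_at_imp_continuous_on)
    (auto simp: solution_def intro: has_vector_derivative_continuous)

lemma add_correction_solution:
  assumes "solution (lin_field A) y"
  shows "solution (nonlin_field A f) (\<lambda>t. y t + correction y t)"
proof -
  have y: "continuous_on UNIV y"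
    by (rule solution_continuous[OF assms])
  have "green_op (\<lambda>s. f s (y s + correction y s)) = correction y"
    by (simp add: fun_eq_iff correction_fixed[OF y])
  with green_op_deriv[OF correction_forcing_continuous[OF y] f_le]
  have "(correction y has_vector_derivative A t *v correction y t + f t (y t + correction y t)) (at t)"
    for t by simp
  with assms show ?thesis
    by (auto simp: solution_def nonlin_field_def lin_field_def matrix_vector_right_distrib add.assoc
        intro: has_vector_derivative_add)
qed

text \<open>
  A linear solution can be recovered from its nonlinear counterpart alone. This is the source of
  both the injectivity of the conjugacy and the formula for its inverse.
\<close>

lemma correction_eq_green_op:
  assumes "solution (lin_field A) y" "x = (\<lambda>t. y t + correction y t)"
  shows "y t = x t - green_op (\<lambda>s. f s (x s)) t"
  using correction_fixed[OF solution_continuous[OF assms(1)]] by (simp add: assms(2))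

end

section \<open>The Hoelder conjugacy\<close>

text \<open>
  Interpolation between two bounds: \<open>e = e\<^sup>1\<^sup>-\<^sup>q e\<^sup>q\<close>, with \<open>e \<le> 2 \<mu>\<close> in the first factor and
  \<open>e \<le> \<gamma> d\<close> in the second.
\<close>

lemma le_powr_of_le_min:
  fixes e \<gamma> \<mu> d q :: real
  assumes "0 \<le> e" "e \<le> \<gamma> * d" "e \<le> 2 * \<mu>" "0 \<le> \<gamma>" "0 \<le> d" "0 < q" "q < 1"
  shows "e \<le> 2 * \<mu> powr (1 - q) * \<gamma> powr q * d powr q"
proof (cases "e = 0")
  case False
  then have "e > 0" "\<mu> > 0"
    using assms by auto
  have "e = e powr (1 - q) * e powr q"
    using \<open>e > 0\<close> by (simp flip: powr_add)
  also have "\<dots> \<le> (2 * \<mu>) powr (1 - q) * (\<gamma> * d) powr q"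
    using assms by (intro mult_mono powr_mono2) auto
  also have "\<dots> = 2 powr (1 - q) * (\<mu> powr (1 - q) * \<gamma> powr q * d powr q)"
    using assms \<open>\<mu> > 0\<close> by (simp add: powr_mult)
  also have "\<dots> \<le> 2 * (\<mu> powr (1 - q) * \<gamma> powr q * d powr q)"
    using powr_mono[of "1 - q" 1 2] assms by (intro mult_right_mono) auto
  finally show ?thesis
    by simp
qed (use assms in auto)

lemma le_powr_self: 
  fixes d q :: real
  shows "0 \<le> d \<Longrightarrow> d \<le> 1 \<Longrightarrow> q \<le> 1 \<Longrightarrow> d \<le> d powr q"
  using powr_mono'[of q 1 d] by (cases "d = 0") auto

locale holder_conjugacy = perturbed_system N A U P Q \<beta> \<alpha> f \<mu> \<gamma>
  for N :: "real ^ 'n \<Rightarrow> real" and A U P Q \<beta> \<alpha> f \<mu> \<gamma> +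
  fixes \<Delta>\<^sub>1 \<Delta>\<^sub>2 :: "real \<Rightarrow> real \<Rightarrow> real" and p q m :: real
  assumes Delta1_continuous: "continuous_on UNIV (\<lambda>(t, s). \<Delta>\<^sub>1 t s)"
    and Delta1_pos: "\<And>t s. \<Delta>\<^sub>1 t s > 0"
    and Delta2_continuous: "continuous_on UNIV (\<lambda>(t, s). \<Delta>\<^sub>2 t s)"
    and Delta2_pos: "\<And>t s. \<Delta>\<^sub>2 t s > 0"
    and linear_divergence: "divergence_bound N (lin_field A) \<Delta>\<^sub>1"
    and nonlinear_divergence: "divergence_bound N (nonlin_field A f) \<Delta>\<^sub>2"
    and p_pos: "0 < p" and q_pos: "0 < q" and q_less_1: "q < 1"
    and m_eq: "m = max \<gamma> (2 * \<mu> powr (1 - q) * \<gamma> powr q)"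
    and linear_weight: "\<And>t. ennreal m *
        (\<integral>\<^sup>+ s. ennreal (op_norm N (G t s) * \<Delta>\<^sub>1 s t powr q) \<partial>lborel) \<le> ennreal (p / (1 + p))"
    and nonlinear_weight: "\<And>t. ennreal m *
        (\<integral>\<^sup>+ s. ennreal (op_norm N (G t s) * \<Delta>\<^sub>2 s t powr q) \<partial>lborel) \<le> ennreal (p / (1 + p))"
begin

lemma m_nonneg: "0 \<le> m" and gamma_le_m: "\<gamma> \<le> m"
  and powr_le_m: "2 * \<mu> powr (1 - q) * \<gamma> powr q \<le> m"
  using gamma_nonneg by (auto simp: m_eq)

lemma weight_measurable:
  assumes "continuous_on UNIV (\<lambda>(t, s). \<Delta> t s)"
  shows "(\<lambda>s. \<Delta> s t powr q :: real) \<in> borel_measurable borel"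
proof -
  have "continuous_on UNIV (\<lambda>s. \<Delta> s t)"
    using continuous_on_compose2[OF assms, of UNIV "\<lambda>s. (s, t)"]
    by (simp add: continuous_on_Pair)
  then have [measurable]: "(\<lambda>s. \<Delta> s t) \<in> borel_measurable borel"
    by (rule borel_measurable_continuous_onI)
  show ?thesis
    by measurable
qed

lemma f_diff_le_powr: "N (f t x - f t x') \<le> m * N (x - x') powr q"
proof -
  have "N (f t x - f t x') \<le> 2 * \<mu>"
    using N_triangle_minus[of "f t x" "f t x'"] f_le[of t x] f_le[of t x'] by linarith
  then have "N (f t x - f t x') \<le> 2 * \<mu> powr (1 - q) * \<gamma> powr q * N (x - x') powr q"
    by (intro le_powr_of_le_min f_lipschitz gamma_nonneg q_pos q_less_1) auto
  also have "\<dots> \<le> m * N (x - x') powr q"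
    by (intro mult_right_mono powr_le_m) auto
  finally show ?thesis .
qed

text \<open>
  The distance \<open>d\<close> of two linear solutions may become large at other times even if it is small at the
  initial one, so both regimes are needed. For \<open>d \<le> 1\<close> the Lipschitz bound suffices as \<open>d \<le> d\<^sup>q\<close>. For
  \<open>d > 1\<close> the arguments of \<open>f\<close> differ by at most \<open>(1 + p) d\<close>, and the interpolated bound applies.
\<close>

lemma f_diff_le_powr_add:
  assumes "N (x - x') \<le> d + p * d powr q" and "0 \<le> d"
  shows "N (f t x - f t x') \<le> m * ((1 + p) * d powr q)"
proof (cases "d \<le> 1")
  case True
  then have "d \<le> d powr q"
    using assms(2) q_less_1 by (intro le_powr_self) auto
  then have "N (x - x') \<le> (1 + p) * d powr q"
    using assms(1) by (simp add: algebra_simps)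
  then have "\<gamma> * N (x - x') \<le> m * ((1 + p) * d powr q)"
    using gamma_le_m m_nonneg by (intro mult_mono) auto
  then show ?thesis
    using f_lipschitz[of t x x'] by linarith
next
  case False
  then have "d powr q \<le> d"
    using q_less_1 powr_mono[of q 1 d] by simp
  then have "p * d powr q \<le> p * d"
    using p_pos by (intro mult_left_mono) auto
  then have "N (x - x') \<le> (1 + p) * d"
    using assms(1) by (simp add: distrib_right)
  then have "N (x - x') powr q \<le> ((1 + p) * d) powr q"
    using q_pos by (intro powr_mono2) auto
  also have "\<dots> \<le> (1 + p) * d powr q"
    using False p_pos q_less_1 powr_mono[of q 1 "1 + p"] by (simp add: powr_mult mult_right_mono)
  finally show ?thesis
    using f_diff_le_powr[of t x x'] m_nonneg by (meson mult_left_mono order_trans)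
qed

lemma divergence_powr_le:
  assumes "divergence_bound N F \<Delta>" "\<And>t s. \<Delta> t s > 0" "solution F z" "solution F w"
  shows "N (z s - w s) powr q \<le> N (z t - w t) powr q * \<Delta> s t powr q"
proof -
  have "N (z s - w s) \<le> \<Delta> s t * N (z t - w t)"
    using assms by (auto simp: divergence_bound_def)
  then have "N (z s - w s) powr q \<le> (\<Delta> s t * N (z t - w t)) powr q"
    using q_pos by (intro powr_mono2) auto
  then show ?thesis
    using assms(2)[of s t] by (simp add: powr_mult mult.commute)
qed

lemma divergence_unique:
  assumes "divergence_bound N F \<Delta>" "solution F z" "solution F w" "z t = w t"
  shows "z = w"
proof
  fix s
  have "N (z s - w s) \<le> \<Delta> s t * N (z t - w t)"
    using assms(1-3) by (auto simp: divergence_bound_def)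
  then have "N (z s - w s) = 0"
    using assms(4) N_nonneg[of "z s - w s"] by simp
  then show "z s = w s"
    by simp
qed

text \<open>
  The bound with constant \<open>p\<close> reproduces itself under the iteration, since the forcing terms differ by
  \<open>m (1 + p)\<close> times the weight and \<open>(1 + p) \<cdot> p / (1 + p) = p\<close>.
\<close>

lemma picard_diff_le:
  assumes y: "solution (lin_field A) y" and y': "solution (lin_field A) y'"
  shows "N (picard y n t - picard y' n t) \<le> p * N (y t - y' t) powr q"
proof (induction n arbitrary: t)
  case 0
  show ?case
    using p_pos by simp
next
  case (Suc n)
  have "N (f s (y s + picard y n s) - f s (y' s + picard y' n s))
      \<le> m * ((1 + p) * N (y t - y' t) powr q * \<Delta>\<^sub>1 s t powr q)" for s
  proof -
    have "N (y s + picard y n s - (y' s + picard y' n s))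
        \<le> N (y s - y' s) + p * N (y s - y' s) powr q"
      using N_triangle[of "y s - y' s" "picard y n s - picard y' n s"] Suc.IH[of s]
      by (simp add: algebra_simps)
    then have "N (f s (y s + picard y n s) - f s (y' s + picard y' n s))
        \<le> m * ((1 + p) * N (y s - y' s) powr q)"
      by (rule f_diff_le_powr_add) simp
    also have "\<dots> \<le> m * ((1 + p) * (N (y t - y' t) powr q * \<Delta>\<^sub>1 s t powr q))"
      using p_pos
      by (intro mult_left_mono m_nonneg divergence_powr_le[OF linear_divergence Delta1_pos y y']) auto
    finally show ?thesis
      by (simp add: mult.assoc)
  qed
  then have "N (picard y (Suc n) t - picard y' (Suc n) t)
      \<le> ((1 + p) * N (y t - y' t) powr q) * (p / (1 + p))"
    unfolding picard.simps using p_pos m_nonneg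
    by (intro green_op_diff_le_weighted[OF picard_forcing_continuous f_le picard_forcing_continuous f_le
          weight_measurable[OF Delta1_continuous] _ linear_weight] solution_continuous[OF y]
          solution_continuous[OF y']) auto
  also have "\<dots> = p * N (y t - y' t) powr q"
    using p_pos by (simp add: field_simps)
  finally show ?case .
qed

lemma correction_diff_le:
  assumes y: "solution (lin_field A) y" and y': "solution (lin_field A) y'"
  shows "N (correction y t - correction y' t) \<le> p * N (y t - y' t) powr q"
proof (rule tendsto_upperbound)
  show "(\<lambda>n. N (picard y n t - picard y' n t)) \<longlonglongrightarrow> N (correction y t - correction y' t)"
    by (intro N_tendsto tendsto_diff picard_tendsto solution_continuous[OF y] solution_continuous[OF y'])
qed (auto simp: picard_diff_le[OF y y'])

definition lin_orbit :: "real \<Rightarrow> real ^ 'n \<Rightarrow> real \<Rightarrow> real ^ 'n" where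
  "lin_orbit t \<eta> = (\<lambda>s. U s *v (V t *v \<eta>))"

lemma lin_orbit_solution: "solution (lin_field A) (lin_orbit t \<eta>)"
  unfolding solution_def lin_field_def lin_orbit_def
proof
  fix s
  from bounded_bilinear.has_vector_derivative[OF bounded_bilinear_matrix_vector U_deriv
      has_vector_derivative_const[of "V t *v \<eta>"], of s]
  show "((\<lambda>s. U s *v (V t *v \<eta>)) has_vector_derivative A s *v (U s *v (V t *v \<eta>))) (at s)"
    by (simp flip: matrix_vector_mul_assoc)
qed

lemma lin_orbit_initial [simp]: "lin_orbit t \<eta> t = \<eta>"
  by (simp add: lin_orbit_def matrix_vector_mul_assoc U_inverse)

lemma lin_orbit_unique: "solution (lin_field A) y \<Longrightarrow> lin_orbit t (y t) = y"
  by (rule divergence_unique[OF linear_divergence lin_orbit_solution, of _ _ _ t]) auto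

text \<open>
  The map \<open>\<L>(t,\<cdot>)\<close> of the conjugacy; the equivalent function is its inverse.
\<close>

definition lift :: "real \<Rightarrow> real ^ 'n \<Rightarrow> real ^ 'n" where
  "lift t \<eta> = \<eta> + correction (lin_orbit t \<eta>) t"

lemma lift_along_solution: "solution (lin_field A) y \<Longrightarrow> lift t (y t) = y t + correction y t"
  by (simp add: lift_def lin_orbit_unique)

lemma lift_solution: "solution (lin_field A) y \<Longrightarrow> solution (nonlin_field A f) (\<lambda>t. lift t (y t))"
  by (simp add: lift_along_solution add_correction_solution)

lemma lift_le: "N (lift t \<eta> - \<eta>) \<le> 2 * \<beta> / \<alpha> * \<mu>"
  using correction_le[OF solution_continuous[OF lin_orbit_solution]] by (simp add: lift_def)

lemma powr_add_le:
  assumes "0 \<le> d" "d < 1"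
  shows "d + p * d powr q \<le> (1 + p) * d powr q"
  using le_powr_self[of d q] assms q_less_1 by (simp add: algebra_simps)

lemma lift_holder:
  assumes "N (y - y') < 1"
  shows "N (lift t y - lift t y') \<le> (1 + p) * N (y - y') powr q"
proof -
  have "N (lift t y - lift t y')
      \<le> N (y - y') + N (correction (lin_orbit t y) t - correction (lin_orbit t y') t)"
    using N_triangle[of "y - y'" "correction (lin_orbit t y) t - correction (lin_orbit t y') t"]
    by (simp add: lift_def algebra_simps)
  also have "\<dots> \<le> N (y - y') + p * N (y - y') powr q"
    using correction_diff_le[OF lin_orbit_solution[of t y] lin_orbit_solution[of t y'], of t] by simp
  also have "\<dots> \<le> (1 + p) * N (y - y') powr q"
    using assms by (intro powr_add_le) auto
  finally show ?thesis .
qed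

lemma lift_continuous: "continuous_on UNIV (lift t)"
  by (rule holder_imp_continuous[OF lift_holder q_pos])

text \<open>
  A solution of \<open>lift t \<eta> = x\<close> is a fixed point of \<open>\<eta> \<mapsto> x + \<eta> - lift t \<eta>\<close>, which maps a ball around \<open>x\<close> into
  itself because \<open>lift t\<close> stays at bounded distance from the identity.
\<close>

lemma lift_surj: "\<exists>\<eta>. lift t \<eta> = x"
proof -
  obtain c where c: "c > 0" "\<And>x. norm x \<le> c * N x"
    using norm_le_N by blast
  define R where "R = c * (2 * \<beta> / \<alpha> * \<mu>)"
  have "R \<ge> 0"
    using c(1) beta_ge_1 alpha_pos mu_nonneg by (simp add: R_def)
  have "norm (lift t \<eta> - \<eta>) \<le> R" for \<eta>
    using c lift_le[of t \<eta>] unfolding R_def by (meson mult_left_mono order_less_imp_le order_trans)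
  moreover have "x - (x + \<eta> - lift t \<eta>) = lift t \<eta> - \<eta>" for \<eta>
    by simp
  ultimately have "(\<lambda>\<eta>. x + \<eta> - lift t \<eta>) \<in> cball x R \<rightarrow> cball x R"
    by (auto simp: dist_norm)
  moreover have "continuous_on (cball x R) (\<lambda>\<eta>. x + \<eta> - lift t \<eta>)"
    by (intro continuous_intros continuous_on_subset[OF lift_continuous]) auto
  ultimately obtain \<eta> where "x + \<eta> - lift t \<eta> = \<eta>"
    using brouwer[of "cball x R" "\<lambda>\<eta>. x + \<eta> - lift t \<eta>"] \<open>R \<ge> 0\<close> by auto
  then show ?thesis
    by (intro exI[of _ \<eta>]) (simp add: algebra_simps)
qed

text \<open>
  By the uniqueness that \<open>\<Delta>\<^sub>2\<close> provides, a nonlinear solution that meets a lifted linear orbit at one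
  time coincides with it.
\<close>

lemma lift_green_op:
  assumes "solution (nonlin_field A f) x" "lift t \<eta> = x t"
  shows "x = (\<lambda>s. lift s (lin_orbit t \<eta> s))"
    and "lin_orbit t \<eta> s = x s - green_op (\<lambda>s. f s (x s)) s"
proof -
  show x: "x = (\<lambda>s. lift s (lin_orbit t \<eta> s))"
    using assms
    by (intro divergence_unique[OF nonlinear_divergence _ lift_solution[OF lin_orbit_solution], of _ t]) auto
  show "lin_orbit t \<eta> s = x s - green_op (\<lambda>s. f s (x s)) s"
    by (rule correction_eq_green_op[OF lin_orbit_solution])
      (simp add: x lift_along_solution[OF lin_orbit_solution])
qed

lemma lift_inj: "inj (lift t)"
proof
  fix \<eta> \<eta>'
  assume eq: "lift t \<eta> = lift t \<eta>'"
  let ?x = "\<lambda>s. lift s (lin_orbit t \<eta> s)"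
  have "solution (nonlin_field A f) ?x"
    by (rule lift_solution[OF lin_orbit_solution])
  from lift_green_op(2)[OF this, of t \<eta> t] lift_green_op(2)[OF this, of t \<eta>' t]
  show "\<eta> = \<eta>'"
    using eq by simp
qed

lemma lift_bij: "bij (lift t)"
  using lift_inj lift_surj by (metis bijI surjI)

lemma lift_inv: "lift t (inv (lift t) x) = x"
  using lift_bij by (simp add: bij_is_surj surj_f_inv_f)

lemma inv_lift: "inv (lift t) (lift t x) = x"
  using lift_inj by (rule inv_f_f)

lemma inv_lift_green_op:
  assumes "solution (nonlin_field A f) x"
  shows "inv (lift t) (x t) = x t - green_op (\<lambda>s. f s (x s)) t"
  using lift_green_op(2)[OF assms lift_inv, of t t] by simp

lemma inv_lift_solution:
  assumes "solution (nonlin_field A f) x"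
  shows "solution (lin_field A) (\<lambda>t. inv (lift t) (x t))"
proof -
  define y where "y = lin_orbit 0 (inv (lift 0) (x 0))"
  have "x = (\<lambda>s. lift s (y s))"
    unfolding y_def by (rule lift_green_op(1)[OF assms lift_inv])
  then have "(\<lambda>t. inv (lift t) (x t)) = y"
    by (simp add: fun_eq_iff inv_lift)
  then show ?thesis
    by (simp add: y_def lin_orbit_solution)
qed

text \<open>
  Since the inverse is \<open>x(t) - T (f (\<cdot>, x)) t\<close> along nonlinear solutions, the divergence bound \<open>\<Delta>\<^sub>2\<close> controls the
  difference of the forcing terms without any iteration.
\<close>

lemma inv_lift_holder:
  assumes "N (x - x') < 1"
  shows "N (inv (lift t) x - inv (lift t) x') \<le> (1 + p) * N (x - x') powr q"
proof -
  let ?z = "\<lambda>x s. lift s (lin_orbit t (inv (lift t) x) s)"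
  let ?k = "\<lambda>x s. f s (?z x s)"
  have z: "solution (nonlin_field A f) (?z x)" for x
    by (rule lift_solution[OF lin_orbit_solution])
  have zt: "?z x t = x" for x
    by (simp add: lift_inv)
  define g where "g x = green_op (?k x) t" for x
  have inv_eq: "inv (lift t) x = x - g x" for x
    using inv_lift_green_op[OF z, of t x] unfolding zt g_def .
  have cont: "continuous_on UNIV (?k x)" for x
    by (intro f_continuous_along solution_continuous[OF z])
  have "N (?k x s - ?k x' s) \<le> m * (N (x - x') powr q * \<Delta>\<^sub>2 s t powr q)" for s
  proof -
    have "N (?z x s - ?z x' s) powr q \<le> N (?z x t - ?z x' t) powr q * \<Delta>\<^sub>2 s t powr q"
      by (rule divergence_powr_le[OF nonlinear_divergence Delta2_pos z z])
    then have "m * N (?z x s - ?z x' s) powr q \<le> m * (N (x - x') powr q * \<Delta>\<^sub>2 s t powr q)"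
      unfolding zt by (intro mult_left_mono m_nonneg)
    then show ?thesis
      by (rule order_trans[OF f_diff_le_powr])
  qed
  then have "N (g x - g x') \<le> N (x - x') powr q * (p / (1 + p))"
    unfolding g_def using p_pos m_nonneg
    by (intro green_op_diff_le_weighted[OF cont f_le cont f_le
          weight_measurable[OF Delta2_continuous] _ nonlinear_weight]) auto
  also have "\<dots> \<le> N (x - x') powr q * p"
    using p_pos by (intro mult_left_mono) (auto simp: field_simps)
  finally have "N (g x - g x') \<le> p * N (x - x') powr q"
    by (simp add: mult.commute)
  moreover have "N (inv (lift t) x - inv (lift t) x')
      \<le> N (x - x') + N (g x - g x')"
    using N_triangle_minus[of "x - x'" "g x - g x'"]
    by (simp add: inv_eq algebra_simps)
  ultimately show ?thesis
    using powr_add_le[OF N_nonneg assms] by linarith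
qed

lemma equivalent_function_inv_lift: "equivalent_function N A f (\<lambda>t. inv (lift t))"
proof -
  have inv_inv: "inv (inv (lift t)) = lift t" for t
    by (rule inv_inv_eq[OF lift_bij])
  have "homeomorphism UNIV UNIV (inv (lift t)) (lift t)" for t
  proof (rule homeomorphismI)
    show "continuous_on UNIV (inv (lift t))"
      by (rule holder_imp_continuous[OF inv_lift_holder q_pos])
  qed (auto simp: lift_continuous lift_inv inv_lift)
  moreover have "N (inv (lift t) x - x) \<le> 2 * \<beta> / \<alpha> * \<mu>" for t x
    using lift_le[of t "inv (lift t) x"] by (simp add: lift_inv N_minus_commute)
  ultimately show ?thesis
    unfolding equivalent_function_def inv_inv
    using lift_le lift_solution inv_lift_solution by blast
qed

end

theorem theorem3p4:
  fixes N :: "real ^ 'n \<Rightarrow> real"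
    and A U :: "real \<Rightarrow> real ^ 'n ^ 'n"
    and P Q :: "real ^ 'n ^ 'n"
    and f :: "real \<Rightarrow> real ^ 'n \<Rightarrow> real ^ 'n"
    and \<Delta>\<^sub>1 \<Delta>\<^sub>2 :: "real \<Rightarrow> real \<Rightarrow> real"
    and \<alpha> \<beta> \<mu> \<gamma> p q m :: real
  assumes "is_norm N"
    and "continuous_on UNIV A" and "bounded (range A)"
    and "continuous_on UNIV (\<lambda>(t, x). f t x)"
    and "fundamental_matrix A U"
    and "exponential_trichotomy N U P Q \<beta> \<alpha>"
    and "\<mu> \<ge> 0" and "\<gamma> \<ge> 0"
    and "\<And>t x. N (f t x) \<le> \<mu>"
    and "\<And>t x\<^sub>1 x\<^sub>2. N (f t x\<^sub>1 - f t x\<^sub>2) \<le> \<gamma> * N (x\<^sub>1 - x\<^sub>2)"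
    and "3 * \<beta> * \<gamma> * inverse \<alpha> < 1"
    and "continuous_on UNIV (\<lambda>(t, s). \<Delta>\<^sub>1 t s)" and "\<And>t s. \<Delta>\<^sub>1 t s > 0"
    and "continuous_on UNIV (\<lambda>(t, s). \<Delta>\<^sub>2 t s)" and "\<And>t s. \<Delta>\<^sub>2 t s > 0"
    and "divergence_bound N (lin_field A) \<Delta>\<^sub>1"
    and "divergence_bound N (nonlin_field A f) \<Delta>\<^sub>2"
    and "p > 0" and "0 < q" and "q < 1"
    and "m = max \<gamma> (2 * \<mu> powr (1 - q) * \<gamma> powr q)"
    and "ennreal m *
           (SUP t. \<integral>\<^sup>+ s. ennreal (op_norm N (green U P Q t s) * \<Delta>\<^sub>1 s t powr q) \<partial>lborel)
         \<le> ennreal (p / (1 + p))"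
    and "ennreal m *
           (SUP t. \<integral>\<^sup>+ s. ennreal (op_norm N (green U P Q t s) * \<Delta>\<^sub>2 s t powr q) \<partial>lborel)
         \<le> ennreal (p / (1 + p))"
  shows "\<exists>H. equivalent_function N A f H \<and>
           (\<forall>t x x'. N (x - x') < 1 \<longrightarrow>
              N (H t x - H t x') \<le> (1 + p) * N (x - x') powr q) \<and>
           (\<forall>t y y'. N (y - y') < 1 \<longrightarrow>
              N (inv (H t) y - inv (H t) y') \<le> (1 + p) * N (y - y') powr q)"
proof -
  interpret trichotomy N A U P Q \<beta> \<alpha>
    using assms by unfold_locales
  have at: "ennreal m * I t \<le> ennreal c" if "ennreal m * (SUP t. I t) \<le> ennreal c" for I c and t :: real
    using that by (rule order_trans[rotated]) (intro mult_left_mono SUP_upper, auto)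
  interpret holder_conjugacy N A U P Q \<beta> \<alpha> f \<mu> \<gamma> \<Delta>\<^sub>1 \<Delta>\<^sub>2 p q m
  proof unfold_locales
    have "0 \<le> \<beta> * \<gamma> / \<alpha>"
      using beta_ge_1 alpha_pos assms by simp
    then show "2 * \<beta> / \<alpha> * \<gamma> < 1"
      using assms by (simp add: divide_inverse mult_ac)
  qed (use assms at in blast)+
  have "inv (inv (lift t)) = lift t" for t
    by (rule inv_inv_eq[OF lift_bij])
  then show ?thesis
    using equivalent_function_inv_lift inv_lift_holder lift_holder
    by (intro exI[of _ "\<lambda>t. inv (lift t)"]) auto
qed

end
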